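(* Let $n\in\mathbb{N}$ and $w\in\mathbb{R}$. (a) A $2n\times 2n$ real matrix $M$ is a balanced magic square matrix of weight $w$ if and only if $$M=\mathcal{X}_{2n}\begin{pmatrix}Y & \mathcal{O}_n\\ \mathcal{O}_n & Z\end{pmatrix}\mathcal{X}_{2n},$$ where $Y$ is an $n\times n$ semimagic square matrix of weight $2w$ with $\operatorname{tr}Y=2nw$, and $Z$ is any $n\times n$ real matrix with $\operatorname{tr}Z=0$. (b) A $(2n+1)\times(2n+1)$ real matrix $M$ is a balanced magic square matrix of weight $w$ if and only if $$M=\mathcal{X}_{2n+1}\begin{pmatrix}\tilde Y & \mathcal{O}_{n+1,n}\\ \mathcal{O}_{n,n+1} & Z\end{pmatrix}\mathcal{X}_{2n+1},\qquad \tilde Y=\begin{pmatrix}Y+2w\mathcal{E}_n & \sqrt2\,(w\mathcal{I}_n-Y)1_n\\ \sqrt2\,\big((w\mathcal{I}_n-Y^T)1_n\big)^T & w+2\cdot1_n^TY1_n\end{pmatrix},$$ where $Y,Z$ are any $n\times n$ real matrices such that $\operatorname{tr}Y=-2\cdot1_n^TY1_n$ (corresponding to $\operatorname{tr}\tilde Y=(2n+1)w$) and $\operatorname{tr}Z=0$.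
   Context: An $m\times m$ real matrix $M$ is a semimagic square of weight $w$ if each of its rows and columns sums to $mw$; it is a magic square of weight $w$ if, in addition, each of its two diagonals sums to $mw$. A semimagic square $M$ is balanced if $M_{ij}=M_{m+1-i,m+1-j}$ for all $i,j\in\{1,\dots,m\}$. $1_m\in\mathbb{R}^m$ is the column vector with all entries $1$, $0_m$ the null vector, $\mathcal{E}_m$ the $m\times m$ matrix with all entries $1$, $\mathcal{O}_m$ the $m\times m$ null matrix, $\mathcal{O}_{k,l}$ the $k\times l$ null matrix, $\mathcal{I}_m$ the unit matrix, and $\mathcal{J}_m=(\delta_{i,m+1-j})_{i,j=1}^m$. Furthermore $$\mathcal{X}_{2n}=\frac1{\sqrt2}\begin{pmatrix}\mathcal{I}_n & \mathcal{J}_n\\ \mathcal{J}_n & -\mathcal{I}_n\end{pmatrix},\qquad \mathcal{X}_{2n+1}=\begin{pmatrix}\frac1{\sqrt2}\mathcal{I}_n & 0_n & \frac1{\sqrt2}\mathcal{J}_n\\ 0_n^T & 1 & 0_n^T\\ \frac1{\sqrt2}\mathcal{J}_n & 0_n & -\frac1{\sqrt2}\mathcal{I}_n\end{pmatrix}.$$ *)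

theory Defs
  imports "Jordan_Normal_Form.Matrix" Complex_Main
begin

text \<open>Matrices are indexed from \<open>0\<close>, so the mirror image of index \<open>i\<close> is \<open>m - 1 - i\<close>.
  The weight \<open>w\<close> is normalised such that line sums equal \<open>m * w\<close>.\<close>

definition semimagic :: "nat \<Rightarrow> real \<Rightarrow> real mat \<Rightarrow> bool" where
  "semimagic m w M \<longleftrightarrow> M \<in> carrier_mat m m \<and>
     (\<forall>i<m. (\<Sum>j<m. M $$ (i, j)) = real m * w) \<and>
     (\<forall>j<m. (\<Sum>i<m. M $$ (i, j)) = real m * w)"

definition magic :: "nat \<Rightarrow> real \<Rightarrow> real mat \<Rightarrow> bool" where
  "magic m w M \<longleftrightarrow> semimagic m w M \<and>
     (\<Sum>i<m. M $$ (i, i)) = real m * w \<and>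
     (\<Sum>i<m. M $$ (i, m - 1 - i)) = real m * w"

definition balanced :: "nat \<Rightarrow> real mat \<Rightarrow> bool" where
  "balanced m M \<longleftrightarrow> (\<forall>i<m. \<forall>j<m. M $$ (i, j) = M $$ (m - 1 - i, m - 1 - j))"

definition mtrace :: "real mat \<Rightarrow> real" where
  "mtrace A = (\<Sum>i<dim_row A. A $$ (i, i))"

definition ones_vec :: "nat \<Rightarrow> real vec" where
  "ones_vec m = vec m (\<lambda>_. 1)"

definition ones_mat :: "nat \<Rightarrow> real mat" where
  "ones_mat m = mat m m (\<lambda>_. 1)"

definition exchange_mat :: "nat \<Rightarrow> real mat" where
  "exchange_mat m = mat m m (\<lambda>(i, j). if i = m - 1 - j then 1 else 0)"

text \<open>Horizontal juxtaposition, the counterpart of \<^const>\<open>append_rows\<close>.\<close>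

definition append_cols :: "real mat \<Rightarrow> real mat \<Rightarrow> real mat" where
  "append_cols A B = four_block_mat A B (0\<^sub>m 0 (dim_col A)) (0\<^sub>m 0 (dim_col B))"

definition X_even :: "nat \<Rightarrow> real mat" where
  "X_even n = (1 / sqrt 2) \<cdot>\<^sub>m
     four_block_mat (1\<^sub>m n) (exchange_mat n)
                    (exchange_mat n) (- 1\<^sub>m n)"

text \<open>The \<open>3 \<times> 3\<close> block matrix with block sizes \<open>n, 1, n\<close>, grouped as \<open>(n + 1) + n\<close>.\<close>

definition X_odd :: "nat \<Rightarrow> real mat" where
  "X_odd n =
     four_block_mat
       (four_block_mat ((1 / sqrt 2) \<cdot>\<^sub>m 1\<^sub>m n) (0\<^sub>m n 1)
                       (0\<^sub>m 1 n)                 (1\<^sub>m 1))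
       (append_rows ((1 / sqrt 2) \<cdot>\<^sub>m exchange_mat n) (0\<^sub>m 1 n))
       (append_cols ((1 / sqrt 2) \<cdot>\<^sub>m exchange_mat n) (0\<^sub>m n 1))
       (- ((1 / sqrt 2) \<cdot>\<^sub>m 1\<^sub>m n))"

definition Y_tilde :: "nat \<Rightarrow> real \<Rightarrow> real mat \<Rightarrow> real mat" where
  "Y_tilde n w Y =
     four_block_mat
       (Y + (2 * w) \<cdot>\<^sub>m ones_mat n)
       (mat_of_cols n [sqrt 2 \<cdot>\<^sub>v ((w \<cdot>\<^sub>m 1\<^sub>m n - Y) *\<^sub>v ones_vec n)])
       (mat_of_row (sqrt 2 \<cdot>\<^sub>v ((w \<cdot>\<^sub>m 1\<^sub>m n - transpose_mat Y) *\<^sub>v ones_vec n)))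
       (mat 1 1 (\<lambda>_. w + 2 * (ones_vec n \<bullet> (Y *\<^sub>v ones_vec n))))"

end

theory Submission
  imports Defs
begin

text \<open>
  Write \<open>J\<close> for the exchange matrix and \<open>X\<close> for the matrix \<open>X_even\<close> or \<open>X_odd\<close> of size \<open>m\<close>.
  The columns of \<open>X\<close> are an orthonormal eigenbasis of \<open>J\<close>, first the mirror symmetric vectors,
  then the antisymmetric ones. So \<open>X\<close> is symmetric with \<open>X X = 1\<close>, and \<open>X J X = S\<close> is the diagonal
  matrix with \<open>1\<close> on the first half (including a middle index) and \<open>-1\<close> on the second half.
  Put \<open>D = X M X\<close>, that is \<open>M = X D X\<close>. Every condition on \<open>M\<close> becomes a condition on \<open>D\<close>:

  \<^item> \<open>M\<close> is balanced iff it commutes with \<open>J\<close>, hence iff \<open>D\<close> commutes with \<open>S\<close>, hence iff \<open>D\<close> is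
    block diagonal with blocks \<open>U\<close> and \<open>Z\<close> (\<open>balanced_mirror_conj_iff\<close>, \<open>block_diag_iff\<close>).

  \<^item> \<open>M\<close> is semimagic iff the vector of ones is an eigenvector of \<open>M\<close> and of its transpose for the
    value \<open>m w\<close>. Since the ones are mirror symmetric, \<open>X\<close> maps them to a vector supported on the
    first half, with entries \<open>sqrt 2\<close> and, if \<open>m\<close> is odd, a final \<open>1\<close>. So only \<open>U\<close> is constrained:
    this vector must be an eigenvector of \<open>U\<close> and of its transpose.

  \<^item> The diagonal sum of \<open>M\<close> is \<open>tr D = tr U + tr Z\<close>, and the antidiagonal sum is
    \<open>tr (M J) = tr (D S) = tr U - tr Z\<close>. Both equal \<open>m w\<close> iff \<open>tr U = m w\<close> and \<open>tr Z = 0\<close>.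

  This proves \<open>magic_balanced_iff\<close>, the form of the result that is common to both parities.
  If \<open>m = 2 n\<close>, the eigenvector condition says that \<open>U\<close> is semimagic of weight \<open>2 w\<close>. If
  \<open>m = 2 n + 1\<close>, it determines the last row, the last column and the corner entry of \<open>U\<close> from its
  leading block of size \<open>n\<close>; writing that block as \<open>Y\<close> plus \<open>2 w\<close> in each entry, the solution is
  exactly \<open>Y_tilde n w Y\<close> (\<open>Y_tilde_eigen_iff\<close>).
\<close>

section \<open>An orthonormal eigenbasis of the exchange matrix\<close>

text \<open>
  The entries of \<open>X_even\<close> and \<open>X_odd\<close> in one formula, so that both parities are treated at once.
  If the diagonal and the antidiagonal meet, they do so at the middle index, with entry \<open>1\<close>.
\<close>

definition mirror_basis :: "nat \<Rightarrow> real mat" where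
  "mirror_basis m = mat m m (\<lambda>(i, j).
     if i + j + 1 = m then (if i = j then 1 else 1 / sqrt 2)
     else if i = j then (if 2 * i < m then 1 / sqrt 2 else - (1 / sqrt 2))
     else 0)"

definition mirror_sign :: "nat \<Rightarrow> real mat" where
  "mirror_sign m = mat m m (\<lambda>(i, j). if i = j then (if 2 * i < m then 1 else - 1) else 0)"

text \<open>
  The nonzero part of the image of the all-ones vector under \<open>mirror_basis (h + l)\<close>, where the
  first half has \<open>h\<close> indices and the second \<open>l\<close>; index \<open>l\<close> occurs only if \<open>h = l + 1\<close> and is then the
  middle one.
\<close>

definition folded_ones :: "nat \<Rightarrow> nat \<Rightarrow> real vec" where
  "folded_ones h l = vec h (\<lambda>i. if i < l then sqrt 2 else 1)"

lemma mirror_basis_carrier [simp]: "mirror_basis m \<in> carrier_mat m m"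
  and mirror_sign_carrier [simp]: "mirror_sign m \<in> carrier_mat m m"
  and exchange_mat_carrier [simp]: "exchange_mat m \<in> carrier_mat m m"
  and ones_vec_carrier [simp]: "ones_vec m \<in> carrier_vec m"
  and folded_ones_carrier [simp]: "folded_ones h l \<in> carrier_vec h"
  by (simp_all add: mirror_basis_def mirror_sign_def exchange_mat_def ones_vec_def folded_ones_def)

lemma square_mult_closed:
  fixes A B :: "real mat"
  shows "A \<in> carrier_mat m m \<Longrightarrow> B \<in> carrier_mat m m \<Longrightarrow> A * B \<in> carrier_mat m m"
  by simp

lemma square_mult_assoc:
  fixes A B C :: "real mat"
  shows "A \<in> carrier_mat m m \<Longrightarrow> B \<in> carrier_mat m m \<Longrightarrow> C \<in> carrier_mat m m \<Longrightarrow>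
    A * B * C = A * (B * C)"
  by (rule assoc_mult_mat)

lemma mat_mult_entry:
  assumes "A \<in> carrier_mat k m" "B \<in> carrier_mat m l" "i < k" "j < l"
  shows "(A * B) $$ (i, j) = (\<Sum>r<m. A $$ (i, r) * B $$ (r, j))"
  using assms by (simp add: scalar_prod_def atLeast0LessThan)

lemma mat_vec_entry:
  assumes "A \<in> carrier_mat k m" "v \<in> carrier_vec m" "i < k"
  shows "(A *\<^sub>v v) $ i = (\<Sum>r<m. A $$ (i, r) * v $ r)"
  using assms by (simp add: scalar_prod_def atLeast0LessThan)

text \<open>
  A row of the basis matrix has at most two nonzero entries, at \<open>i\<close> and at its mirror image.
\<close>

lemma mirror_basis_row_sum:
  assumes "i < m"
  shows "(\<Sum>j<m. mirror_basis m $$ (i, j) * f j) =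
    (if 2 * i + 1 = m then f i
     else ((if 2 * i < m then f i else - f i) + f (m - 1 - i)) / sqrt 2)"
proof (cases "2 * i + 1 = m")
  case True
  have "(\<Sum>j<m. mirror_basis m $$ (i, j) * f j) = (\<Sum>j\<in>{i}. mirror_basis m $$ (i, j) * f j)"
    using assms True by (intro sum.mono_neutral_right) (auto simp: mirror_basis_def)
  then show ?thesis using assms True by (simp add: mirror_basis_def)
next
  case False
  have "(\<Sum>j<m. mirror_basis m $$ (i, j) * f j) =
      (\<Sum>j\<in>{i, m - 1 - i}. mirror_basis m $$ (i, j) * f j)"
    using assms False by (intro sum.mono_neutral_right) (auto simp: mirror_basis_def)
  moreover have "i \<noteq> m - 1 - i" using assms False by auto
  ultimately show ?thesis using assms False
    by (auto simp: mirror_basis_def add_divide_distrib)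
qed

lemma mirror_basis_symmetric: "transpose_mat (mirror_basis m) = mirror_basis m"
  by (rule eq_matI) (auto simp: mirror_basis_def)

lemma mirror_basis_involution: "mirror_basis m * mirror_basis m = 1\<^sub>m m"
proof (rule eq_matI)
  fix i j assume "i < dim_row (1\<^sub>m m :: real mat)" "j < dim_col (1\<^sub>m m :: real mat)"
  then have ij: "i < m" "j < m" by auto
  have "(mirror_basis m * mirror_basis m) $$ (i, j) =
      (\<Sum>r<m. mirror_basis m $$ (i, r) * mirror_basis m $$ (r, j))"
    using ij by (intro mat_mult_entry[of _ m m _ m]) auto
  also have "\<dots> = (1\<^sub>m m :: real mat) $$ (i, j)"
    using ij by (subst mirror_basis_row_sum) (auto simp: mirror_basis_def field_simps)
  finally show "(mirror_basis m * mirror_basis m) $$ (i, j) = (1\<^sub>m m :: real mat) $$ (i, j)" .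
qed (auto simp: mirror_basis_def)

lemma exchange_mat_mult_entry:
  assumes "A \<in> carrier_mat m m" "i < m" "j < m"
  shows "(exchange_mat m * A) $$ (i, j) = A $$ (m - 1 - i, j)"
proof -
  have "(exchange_mat m * A) $$ (i, j) = (\<Sum>r<m. exchange_mat m $$ (i, r) * A $$ (r, j))"
    using assms by (intro mat_mult_entry[of _ m m _ m]) auto
  also have "\<dots> = (\<Sum>r\<in>{m - 1 - i}. exchange_mat m $$ (i, r) * A $$ (r, j))"
    using assms by (intro sum.mono_neutral_right) (auto simp: exchange_mat_def)
  finally show ?thesis using assms by (simp add: exchange_mat_def)
qed

lemma mult_exchange_mat_entry:
  assumes "A \<in> carrier_mat m m" "i < m" "j < m"
  shows "(A * exchange_mat m) $$ (i, j) = A $$ (i, m - 1 - j)"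
proof -
  have "(A * exchange_mat m) $$ (i, j) = (\<Sum>r<m. A $$ (i, r) * exchange_mat m $$ (r, j))"
    using assms by (intro mat_mult_entry[of _ m m _ m]) auto
  also have "\<dots> = (\<Sum>r\<in>{m - 1 - j}. A $$ (i, r) * exchange_mat m $$ (r, j))"
    using assms by (intro sum.mono_neutral_right) (auto simp: exchange_mat_def)
  finally show ?thesis using assms by (simp add: exchange_mat_def)
qed

lemma mirror_sign_mult_entry:
  assumes "A \<in> carrier_mat m m" "i < m" "j < m"
  shows "(mirror_sign m * A) $$ (i, j) = (if 2 * i < m then A $$ (i, j) else - A $$ (i, j))"
proof -
  have "(mirror_sign m * A) $$ (i, j) = (\<Sum>r<m. mirror_sign m $$ (i, r) * A $$ (r, j))"
    using assms by (intro mat_mult_entry[of _ m m _ m]) auto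
  also have "\<dots> = (\<Sum>r\<in>{i}. mirror_sign m $$ (i, r) * A $$ (r, j))"
    using assms by (intro sum.mono_neutral_right) (auto simp: mirror_sign_def)
  finally show ?thesis using assms by (simp add: mirror_sign_def)
qed

lemma mult_mirror_sign_entry:
  assumes "A \<in> carrier_mat m m" "i < m" "j < m"
  shows "(A * mirror_sign m) $$ (i, j) = (if 2 * j < m then A $$ (i, j) else - A $$ (i, j))"
proof -
  have "(A * mirror_sign m) $$ (i, j) = (\<Sum>r<m. A $$ (i, r) * mirror_sign m $$ (r, j))"
    using assms by (intro mat_mult_entry[of _ m m _ m]) auto
  also have "\<dots> = (\<Sum>r\<in>{j}. A $$ (i, r) * mirror_sign m $$ (r, j))"
    using assms by (intro sum.mono_neutral_right) (auto simp: mirror_sign_def)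
  finally show ?thesis using assms by (simp add: mirror_sign_def)
qed

text \<open>
  The eigenvector property: reversing column \<open>j\<close> of the basis matrix multiplies it by the
  eigenvalue \<open>1\<close> or \<open>-1\<close> belonging to \<open>j\<close>.
\<close>

lemma exchange_mirror_basis: "exchange_mat m * mirror_basis m = mirror_basis m * mirror_sign m"
proof (rule eq_matI)
  fix i j assume "i < dim_row (mirror_basis m * mirror_sign m)"
    "j < dim_col (mirror_basis m * mirror_sign m)"
  then have ij: "i < m" "j < m" by (auto simp: mirror_basis_def mirror_sign_def)
  then show "(exchange_mat m * mirror_basis m) $$ (i, j) =
      (mirror_basis m * mirror_sign m) $$ (i, j)"
    by (subst exchange_mat_mult_entry, simp, simp, simp, subst mult_mirror_sign_entry)
      (auto simp: mirror_basis_def)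
qed (auto simp: mirror_basis_def mirror_sign_def exchange_mat_def)

section \<open>Conjugation by the eigenbasis\<close>

abbreviation mirror_conj :: "nat \<Rightarrow> real mat \<Rightarrow> real mat" where
  "mirror_conj m A \<equiv> mirror_basis m * A * mirror_basis m"

lemma mirror_conj_mult:
  assumes A: "A \<in> carrier_mat m m" and B: "B \<in> carrier_mat m m"
  shows "mirror_conj m A * mirror_conj m B = mirror_conj m (A * B)"
proof -
  let ?X = "mirror_basis m"
  note c = mirror_basis_carrier[of m] A B square_mult_closed[where m = m]
  have "?X * A * ?X * (?X * B * ?X) = ?X * A * (?X * (?X * (B * ?X)))"
    by (simp only: square_mult_assoc[where m = m] c)
  also have "?X * (?X * (B * ?X)) = ?X * ?X * (B * ?X)"
    using c by (intro assoc_mult_mat[of _ m m _ m _ m, symmetric]) auto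
  also have "\<dots> = B * ?X"
    using c by (simp add: mirror_basis_involution)
  finally show ?thesis by (simp only: square_mult_assoc[where m = m] c)
qed

lemma mirror_conj_involution:
  assumes A: "A \<in> carrier_mat m m"
  shows "mirror_conj m (mirror_conj m A) = A"
proof -
  let ?X = "mirror_basis m"
  note c = mirror_basis_carrier[of m] A square_mult_closed[where m = m]
  have "?X * (?X * A * ?X) * ?X = (?X * ?X) * A * (?X * ?X)"
    by (simp only: square_mult_assoc[where m = m] c)
  also have "\<dots> = A"
    using A by (simp add: mirror_basis_involution)
  finally show ?thesis .
qed

lemma mirror_conj_inject:
  assumes "A \<in> carrier_mat m m" "B \<in> carrier_mat m m"
  shows "mirror_conj m A = mirror_conj m B \<longleftrightarrow> A = B"
  using assms mirror_conj_involution by metis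

lemma mirror_conj_sign: "mirror_conj m (mirror_sign m) = exchange_mat m"
proof -
  have "mirror_conj m (mirror_sign m) = exchange_mat m * mirror_basis m * mirror_basis m"
    by (simp add: exchange_mirror_basis)
  also have "\<dots> = exchange_mat m * (mirror_basis m * mirror_basis m)"
    by (intro assoc_mult_mat[of _ m m _ m _ m]) auto
  also have "\<dots> = exchange_mat m"
    unfolding mirror_basis_involution by (rule right_mult_one_mat[of _ m]) simp
  finally show ?thesis .
qed

section \<open>Balanced matrices and block diagonal form\<close>

text \<open>
  Being balanced means \<open>J M J = M\<close>; the form without conjugation follows by mirroring one of the
  two indices.
\<close>

lemma balanced_iff_commutes:
  assumes M: "M \<in> carrier_mat m m"
  shows "balanced m M \<longleftrightarrow> exchange_mat m * M = M * exchange_mat m"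
proof
  assume b: "balanced m M"
  show "exchange_mat m * M = M * exchange_mat m"
  proof (rule eq_matI)
    fix i j assume "i < dim_row (M * exchange_mat m)" "j < dim_col (M * exchange_mat m)"
    then have ij: "i < m" "j < m" using M by (auto simp: exchange_mat_def)
    then have "m - 1 - j < m" by simp
    then have "M $$ (i, m - 1 - j) = M $$ (m - 1 - i, m - 1 - (m - 1 - j))"
      using b ij unfolding balanced_def by blast
    then show "(exchange_mat m * M) $$ (i, j) = (M * exchange_mat m) $$ (i, j)"
      using ij by (simp add: exchange_mat_mult_entry[OF M] mult_exchange_mat_entry[OF M] del: index_mult_mat)
  qed (use M in \<open>auto simp: exchange_mat_def\<close>)
next
  assume c: "exchange_mat m * M = M * exchange_mat m"
  show "balanced m M"
    unfolding balanced_def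
  proof (intro allI impI)
    fix i j assume ij: "i < m" "j < m"
    have "(exchange_mat m * M) $$ (i, m - 1 - j) = (M * exchange_mat m) $$ (i, m - 1 - j)"
      using c by simp
    then show "M $$ (i, j) = M $$ (m - 1 - i, m - 1 - j)"
      using ij by (simp add: exchange_mat_mult_entry[OF M] mult_exchange_mat_entry[OF M] del: index_mult_mat)
  qed
qed

text \<open>
  Conjugation turns commuting with \<open>J\<close> into commuting with the diagonal sign matrix. Entrywise
  this compares \<open>D $$ (i, j)\<close> under the two signs of its row and column, so it must vanish
  where these signs differ.
\<close>

lemma balanced_mirror_conj_iff:
  assumes D: "D \<in> carrier_mat m m"
  shows "balanced m (mirror_conj m D) \<longleftrightarrow>
    (\<forall>i<m. \<forall>j<m. (2 * i < m) \<noteq> (2 * j < m) \<longrightarrow> D $$ (i, j) = 0)"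
proof -
  have c: "mirror_conj m D \<in> carrier_mat m m"
    using D by (simp add: mult_carrier_mat[of _ m m _ m])
  have "balanced m (mirror_conj m D) \<longleftrightarrow> mirror_sign m * D = D * mirror_sign m"
    unfolding balanced_iff_commutes[OF c] mirror_conj_sign[symmetric]
    using D by (simp add: mirror_conj_mult mirror_conj_inject mult_carrier_mat[of _ m m _ m])
  also have "\<dots> \<longleftrightarrow> (\<forall>i<m. \<forall>j<m. (mirror_sign m * D) $$ (i, j) = (D * mirror_sign m) $$ (i, j))"
    using D by (auto simp: mat_eq_iff mirror_sign_def simp del: index_mult_mat(1))
  also have "\<dots> \<longleftrightarrow> (\<forall>i<m. \<forall>j<m. (2 * i < m) \<noteq> (2 * j < m) \<longrightarrow> D $$ (i, j) = 0)"
    by (auto simp: mirror_sign_mult_entry[OF D] mult_mirror_sign_entry[OF D] simp del: index_mult_mat(1) split: if_splits)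
  finally show ?thesis .
qed

lemma block_diag_iff:
  fixes D :: "real mat"
  assumes D: "D \<in> carrier_mat (h + l) (h + l)" and hl: "h = l \<or> h = Suc l"
  shows "(\<forall>i<h + l. \<forall>j<h + l. (2 * i < h + l) \<noteq> (2 * j < h + l) \<longrightarrow> D $$ (i, j) = 0) \<longleftrightarrow>
    (\<exists>U\<in>carrier_mat h h. \<exists>Z\<in>carrier_mat l l. D = four_block_mat U (0\<^sub>m h l) (0\<^sub>m l h) Z)"
    (is "?L \<longleftrightarrow> ?R")
proof
  \<comment> \<open>The eigenvalue signs change exactly at the border between the two blocks.\<close>
  have half: "2 * i < h + l \<longleftrightarrow> i < h" for i using hl by auto
  {
    assume L: ?L
    obtain U B C Z where s: "split_block D h h = (U, B, C, Z)"
      by (metis prod_cases4)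
    note b = split_block[OF s, of l l]
    have c: "U \<in> carrier_mat h h" "B \<in> carrier_mat h l" "C \<in> carrier_mat l h" "Z \<in> carrier_mat l l"
      and eq: "D = four_block_mat U B C Z"
      using b D by auto
    have "B = 0\<^sub>m h l"
      using s D L by (auto simp: split_block_def Let_def half intro!: eq_matI)
    moreover have "C = 0\<^sub>m l h"
      using s D L by (auto simp: split_block_def Let_def half intro!: eq_matI)
    ultimately show ?R using c eq by auto
  next
    assume ?R
    then show ?L by (auto simp: half)
  }
qed

section \<open>Traces\<close>

lemma mtrace_mult_commute:
  assumes "A \<in> carrier_mat m m" "B \<in> carrier_mat m m"
  shows "mtrace (A * B) = mtrace (B * A)"
proof -
  have "mtrace (A * B) = (\<Sum>i<m. \<Sum>r<m. A $$ (i, r) * B $$ (r, i))"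
    using assms by (simp add: mtrace_def mat_mult_entry[of A m m B m] del: index_mult_mat(1))
  also have "\<dots> = (\<Sum>r<m. \<Sum>i<m. B $$ (r, i) * A $$ (i, r))"
    by (subst sum.swap) (simp add: mult.commute)
  also have "\<dots> = mtrace (B * A)"
    using assms by (simp add: mtrace_def mat_mult_entry[of B m m A m] del: index_mult_mat(1))
  finally show ?thesis .
qed

lemma mtrace_mirror_conj:
  assumes D: "D \<in> carrier_mat m m"
  shows "mtrace (mirror_conj m D) = mtrace D"
proof -
  let ?X = "mirror_basis m"
  have "mtrace (?X * D * ?X) = mtrace (?X * (?X * D))"
    using D by (intro mtrace_mult_commute[of _ m]) (auto intro!: mult_carrier_mat[of _ m m _ m])
  also have "?X * (?X * D) = ?X * ?X * D"
    using D by (intro assoc_mult_mat[of _ m m _ m _ m, symmetric]) auto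
  finally show ?thesis using D by (simp add: mirror_basis_involution)
qed

lemma mtrace_block_diag:
  assumes "U \<in> carrier_mat h h" "Z \<in> carrier_mat l l"
  shows "mtrace (four_block_mat U B C Z) = mtrace U + mtrace Z"
proof -
  have "(\<Sum>i<h + l. f i) = (\<Sum>i<h. f i) + (\<Sum>i<l. f (h + i))" for f :: "nat \<Rightarrow> real"
    by (induct l) (auto simp: add.assoc)
  then show ?thesis using assms by (auto simp: mtrace_def)
qed

text \<open>
  This trace is the antidiagonal sum of the conjugated matrix: the sign matrix plays the part of
  \<open>J\<close> and negates the second block.
\<close>

lemma mtrace_block_diag_sign:
  assumes U: "U \<in> carrier_mat h h" and Z: "Z \<in> carrier_mat l l" and hl: "h = l \<or> h = Suc l"
  shows "mtrace (four_block_mat U (0\<^sub>m h l) (0\<^sub>m l h) Z * mirror_sign (h + l)) = mtrace U - mtrace Z"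
proof -
  \<comment> \<open>The eigenvalue signs change exactly at the border between the two blocks.\<close>
  have half: "2 * i < h + l \<longleftrightarrow> i < h" for i using hl by auto
  have "four_block_mat U (0\<^sub>m h l) (0\<^sub>m l h) Z * mirror_sign (h + l) =
      four_block_mat U (0\<^sub>m h l) (0\<^sub>m l h) (- Z)"
  proof (rule eq_matI)
    fix i j assume "i < dim_row (four_block_mat U (0\<^sub>m h l) (0\<^sub>m l h) (- Z))"
      "j < dim_col (four_block_mat U (0\<^sub>m h l) (0\<^sub>m l h) (- Z))"
    then have ij: "i < h + l" "j < h + l" using U Z by auto
    show "(four_block_mat U (0\<^sub>m h l) (0\<^sub>m l h) Z * mirror_sign (h + l)) $$ (i, j) =
        four_block_mat U (0\<^sub>m h l) (0\<^sub>m l h) (- Z) $$ (i, j)"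
      using ij U Z by (subst mult_mirror_sign_entry) (auto simp: half)
  qed (use U Z in \<open>auto simp: mirror_sign_def\<close>)
  then show ?thesis
    using mtrace_block_diag[of U h "- Z" l] U Z by (simp add: mtrace_def sum_negf)
qed

section \<open>Line sums as an eigenvector condition\<close>

lemma semimagic_iff_eigen:
  assumes M: "M \<in> carrier_mat m m"
  shows "semimagic m w M \<longleftrightarrow>
    M *\<^sub>v ones_vec m = (real m * w) \<cdot>\<^sub>v ones_vec m \<and>
    transpose_mat M *\<^sub>v ones_vec m = (real m * w) \<cdot>\<^sub>v ones_vec m"
  using M by (auto simp: semimagic_def vec_eq_iff scalar_prod_def ones_vec_def atLeast0LessThan)

text \<open>Multiplication by \<open>J\<close> reverses the columns and moves the antidiagonal to the diagonal.\<close>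

lemma magic_iff:
  assumes M: "M \<in> carrier_mat m m"
  shows "magic m w M \<longleftrightarrow> semimagic m w M \<and> mtrace M = real m * w \<and>
    mtrace (M * exchange_mat m) = real m * w"
  using M by (simp add: magic_def mtrace_def mult_exchange_mat_entry[OF M] del: index_mult_mat(1))

lemma eigen_mirror_conj:
  assumes D: "D \<in> carrier_mat m m" and v: "v \<in> carrier_vec m"
  shows "mirror_conj m D *\<^sub>v v = c \<cdot>\<^sub>v v \<longleftrightarrow>
    D *\<^sub>v (mirror_basis m *\<^sub>v v) = c \<cdot>\<^sub>v (mirror_basis m *\<^sub>v v)"
proof -
  let ?X = "mirror_basis m"
  have XX: "?X *\<^sub>v (?X *\<^sub>v u) = u" if "u \<in> carrier_vec m" for u
    using that assoc_mult_mat_vec[of ?X m m ?X m u] by (simp add: mirror_basis_involution)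
  have "mirror_conj m D *\<^sub>v v = ?X *\<^sub>v (D *\<^sub>v (?X *\<^sub>v v))"
    using D v by (simp add: assoc_mult_mat_vec[of _ m m _ m] mult_carrier_mat[of _ m m _ m]
        mult_mat_vec_carrier[of _ m m])
  moreover have "?X *\<^sub>v (D *\<^sub>v (?X *\<^sub>v v)) = c \<cdot>\<^sub>v v \<longleftrightarrow> 
      ?X *\<^sub>v (?X *\<^sub>v (D *\<^sub>v (?X *\<^sub>v v))) = ?X *\<^sub>v (c \<cdot>\<^sub>v v)"
    using D v XX by (metis smult_carrier_vec mult_mat_vec_carrier mirror_basis_carrier)
  moreover have "?X *\<^sub>v (?X *\<^sub>v (D *\<^sub>v (?X *\<^sub>v v))) = D *\<^sub>v (?X *\<^sub>v v)"
    using D v by (intro XX) (auto intro!: mult_mat_vec_carrier[of _ m m])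
  moreover have "?X *\<^sub>v (c \<cdot>\<^sub>v v) = c \<cdot>\<^sub>v (?X *\<^sub>v v)"
    using v by (intro mult_mat_vec[of _ m m]) auto
  ultimately show ?thesis by simp
qed

lemma transpose_mirror_conj:
  assumes D: "D \<in> carrier_mat m m"
  shows "transpose_mat (mirror_conj m D) = mirror_conj m (transpose_mat D)"
  using D by (simp add: transpose_mult[of _ m m _ m] mult_carrier_mat[of _ m m _ m] 
      mirror_basis_symmetric assoc_mult_mat[of _ m m _ m _ m])

text \<open>
  The antisymmetric basis vectors are orthogonal to the all-ones vector, so the coordinates in
  the second half vanish; a symmetric pair contributes \<open>2 / sqrt 2\<close>.
\<close>

lemma mirror_basis_ones:
  assumes hl: "h = l \<or> h = Suc l"
  shows "mirror_basis (h + l) *\<^sub>v ones_vec (h + l) = folded_ones h l @\<^sub>v 0\<^sub>v l"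
proof (rule eq_vecI)
  fix i assume "i < dim_vec (folded_ones h l @\<^sub>v 0\<^sub>v l)"
  then have i: "i < h + l" by (simp add: folded_ones_def)
  \<comment> \<open>If the two halves have equal size, there is no middle index.\<close>
  have even: "2 * i + 1 \<noteq> l + l" by presburger
  have "(mirror_basis (h + l) *\<^sub>v ones_vec (h + l)) $ i =
      (\<Sum>r<h + l. mirror_basis (h + l) $$ (i, r) * ones_vec (h + l) $ r)"
    using i by (intro mat_vec_entry[of _ "h + l"]) auto
  also have "\<dots> = (\<Sum>r<h + l. mirror_basis (h + l) $$ (i, r) * 1)"
    by (intro sum.cong) (auto simp: ones_vec_def)
  also have "\<dots> = (folded_ones h l @\<^sub>v 0\<^sub>v l) $ i"
    using i hl even unfolding mirror_basis_row_sum[OF i, of "\<lambda>_. 1"]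
    by (auto simp: folded_ones_def real_div_sqrt)
  finally show "(mirror_basis (h + l) *\<^sub>v ones_vec (h + l)) $ i =
      (folded_ones h l @\<^sub>v 0\<^sub>v l) $ i" .
qed (simp add: folded_ones_def mirror_basis_def)

lemma block_diag_eigen:
  fixes U Z :: "real mat"
  assumes U: "U \<in> carrier_mat h h" and Z: "Z \<in> carrier_mat l l" and u: "u \<in> carrier_vec h"
  shows "four_block_mat U (0\<^sub>m h l) (0\<^sub>m l h) Z *\<^sub>v (u @\<^sub>v 0\<^sub>v l) = c \<cdot>\<^sub>v (u @\<^sub>v 0\<^sub>v l) \<longleftrightarrow>
    U *\<^sub>v u = c \<cdot>\<^sub>v u"
proof -
  have "four_block_mat U (0\<^sub>m h l) (0\<^sub>m l h) Z *\<^sub>v (u @\<^sub>v 0\<^sub>v l) = (U *\<^sub>v u) @\<^sub>v 0\<^sub>v l"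
    using assms by (subst four_block_mat_mult_vec[of _ h h _ l _ l])
      (auto intro!: arg_cong2[of _ _ _ _ append_vec] eq_vecI simp: scalar_prod_def)
  moreover have "c \<cdot>\<^sub>v (u @\<^sub>v 0\<^sub>v l) = (c \<cdot>\<^sub>v u) @\<^sub>v 0\<^sub>v l"
    using u by (auto intro!: eq_vecI)
  ultimately show ?thesis
    using append_vec_eq[of "U *\<^sub>v u" h "c \<cdot>\<^sub>v u" "0\<^sub>v l" "0\<^sub>v l"] assms by auto
qed

section \<open>Balanced magic squares of either parity\<close>

text \<open>
  The row and column sums and the two diagonals constrain the blocks separately: the sums see
  only \<open>U\<close>, and the sum and difference of the two diagonal conditions separate \<open>tr U\<close> from \<open>tr Z\<close>.
\<close>

lemma magic_balanced_iff:
  assumes hl: "h = l \<or> h = Suc l" and m: "m = h + l" and M: "M \<in> carrier_mat m m"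
  shows "magic m w M \<and> balanced m M \<longleftrightarrow>
    (\<exists>U\<in>carrier_mat h h. \<exists>Z\<in>carrier_mat l l.
       M = mirror_basis m * four_block_mat U (0\<^sub>m h l) (0\<^sub>m l h) Z * mirror_basis m \<and>
       U *\<^sub>v folded_ones h l = (real m * w) \<cdot>\<^sub>v folded_ones h l \<and>
       transpose_mat U *\<^sub>v folded_ones h l = (real m * w) \<cdot>\<^sub>v folded_ones h l \<and>
       mtrace U = real m * w \<and> mtrace Z = 0)"
proof -
  let ?D = "\<lambda>U Z. four_block_mat U (0\<^sub>m h l) (0\<^sub>m l h) Z"
  have carr: "mirror_conj m A \<in> carrier_mat m m" if "A \<in> carrier_mat m m" for A
    using that by (simp add: mult_carrier_mat[of _ m m _ m])
  have bal: "balanced m M \<longleftrightarrow>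
      (\<exists>U\<in>carrier_mat h h. \<exists>Z\<in>carrier_mat l l. M = mirror_conj m (?D U Z))"
  proof -
    let ?E = "mirror_conj m M"
    have "balanced m M \<longleftrightarrow> (\<exists>U\<in>carrier_mat h h. \<exists>Z\<in>carrier_mat l l. ?E = ?D U Z)"
      using balanced_mirror_conj_iff[OF carr[OF M], unfolded mirror_conj_involution[OF M]]
        block_diag_iff[of ?E h l, OF _ hl] carr[OF M]
      unfolding m by simp
    moreover have "?E = ?D U Z \<longleftrightarrow> M = mirror_conj m (?D U Z)"
      if "U \<in> carrier_mat h h" "Z \<in> carrier_mat l l" for U Z
      using mirror_conj_involution[OF M] mirror_conj_involution[of "?D U Z" m] that m by auto
    ultimately show ?thesis by auto
  qed
  have mag: "magic m w (mirror_conj m (?D U Z)) \<longleftrightarrow>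
       U *\<^sub>v folded_ones h l = (real m * w) \<cdot>\<^sub>v folded_ones h l \<and>
       transpose_mat U *\<^sub>v folded_ones h l = (real m * w) \<cdot>\<^sub>v folded_ones h l \<and>
       mtrace U = real m * w \<and> mtrace Z = 0"
    if U: "U \<in> carrier_mat h h" and Z: "Z \<in> carrier_mat l l" for U Z
  proof -
    have D: "?D U Z \<in> carrier_mat m m" using U Z m by simp
    have ones: "mirror_basis m *\<^sub>v ones_vec m = folded_ones h l @\<^sub>v 0\<^sub>v l"
      unfolding m by (rule mirror_basis_ones[OF hl])
    have T: "transpose_mat (?D U Z) = ?D (transpose_mat U) (transpose_mat Z)"
      using U Z by (subst transpose_four_block_mat[of _ h h _ l _ l]) auto
    have "semimagic m w (mirror_conj m (?D U Z)) \<longleftrightarrow>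
       U *\<^sub>v folded_ones h l = (real m * w) \<cdot>\<^sub>v folded_ones h l \<and>
       transpose_mat U *\<^sub>v folded_ones h l = (real m * w) \<cdot>\<^sub>v folded_ones h l"
      unfolding semimagic_iff_eigen[OF carr[OF D]] transpose_mirror_conj[OF D]
      using D U Z T block_diag_eigen[OF U Z folded_ones_carrier]
        block_diag_eigen[of "transpose_mat U" h "transpose_mat Z" l, OF _ _ folded_ones_carrier]
        eigen_mirror_conj[OF D ones_vec_carrier, unfolded ones]
        eigen_mirror_conj[of "transpose_mat (?D U Z)" m, OF _ ones_vec_carrier, unfolded ones]
        transpose_carrier_mat[THEN iffD2, OF D]
      by simp
    moreover have "mtrace (mirror_conj m (?D U Z)) = mtrace U + mtrace Z"
      using mtrace_mirror_conj[OF D] mtrace_block_diag[OF U Z] by simp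
    moreover have "mtrace (mirror_conj m (?D U Z) * exchange_mat m) = mtrace U - mtrace Z"
    proof -
      have "mirror_conj m (?D U Z) * exchange_mat m = mirror_conj m (?D U Z * mirror_sign m)"
        using mirror_conj_mult[OF D mirror_sign_carrier] by (simp add: mirror_conj_sign)
      then show ?thesis
        using mtrace_mirror_conj[of "?D U Z * mirror_sign m" m] D
          mtrace_block_diag_sign[OF U Z hl] m by (simp add: mult_carrier_mat[of _ m m _ m])
    qed
    ultimately show ?thesis
      unfolding magic_iff[OF carr[OF D]] by auto
  qed
  show ?thesis using bal mag by metis
qed

section \<open>Even order\<close>

lemma X_even_eq: "X_even n = mirror_basis (2 * n)"
  by (rule eq_matI) (auto simp: X_even_def exchange_mat_def mirror_basis_def)

text \<open>
  In even order the folded ones are \<open>sqrt 2\<close> times the all-ones vector, so the eigenvector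
  condition again states line sums, now \<open>2 n w\<close> in a square of size \<open>n\<close>: the weight doubles.
\<close>

lemma semimagic_iff_folded:
  assumes Y: "Y \<in> carrier_mat n n"
  shows "semimagic n (2 * w) Y \<longleftrightarrow>
    Y *\<^sub>v folded_ones n n = (real (2 * n) * w) \<cdot>\<^sub>v folded_ones n n \<and>
    transpose_mat Y *\<^sub>v folded_ones n n = (real (2 * n) * w) \<cdot>\<^sub>v folded_ones n n"
proof -
  have f: "folded_ones n n = sqrt 2 \<cdot>\<^sub>v ones_vec n"
    by (auto simp: folded_ones_def ones_vec_def intro!: eq_vecI)
  have "A *\<^sub>v folded_ones n n = (real (2 * n) * w) \<cdot>\<^sub>v folded_ones n n \<longleftrightarrow>
      A *\<^sub>v ones_vec n = (real n * (2 * w)) \<cdot>\<^sub>v ones_vec n"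
    if A: "A \<in> carrier_mat n n" for A
    unfolding f using A mult_mat_vec[OF A ones_vec_carrier, of "sqrt 2"]
    by (auto simp: vec_eq_iff algebra_simps)
  from this[OF Y] this[of "transpose_mat Y"] Y show ?thesis
    by (simp add: semimagic_iff_eigen)
qed

section \<open>Odd order\<close>

lemma X_odd_eq: "X_odd n = mirror_basis (2 * n + 1)"
  by (rule eq_matI)
    (auto simp: X_odd_def exchange_mat_def append_rows_def append_cols_def mirror_basis_def)

lemma Y_tilde_carrier [simp]:
  "Y \<in> carrier_mat n n \<Longrightarrow> Y_tilde n w Y \<in> carrier_mat (n + 1) (n + 1)"
  by (intro carrier_matI) (simp_all add: Y_tilde_def ones_mat_def)

lemma Y_tilde_entries:
  assumes Y: "Y \<in> carrier_mat n n"
  shows "i < n \<Longrightarrow> j < n \<Longrightarrow> Y_tilde n w Y $$ (i, j) = Y $$ (i, j) + 2 * w"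
    and "i < n \<Longrightarrow> Y_tilde n w Y $$ (i, n) = sqrt 2 * (w - (\<Sum>j<n. Y $$ (i, j)))"
    and "j < n \<Longrightarrow> Y_tilde n w Y $$ (n, j) = sqrt 2 * (w - (\<Sum>i<n. Y $$ (i, j)))"
    and "Y_tilde n w Y $$ (n, n) = w + 2 * (\<Sum>i<n. \<Sum>j<n. Y $$ (i, j))"
proof -
  have sv: "((w \<cdot>\<^sub>m 1\<^sub>m n - A) *\<^sub>v ones_vec n) $ i = w - (\<Sum>j<n. A $$ (i, j))"
    if A: "A \<in> carrier_mat n n" and i: "i < n" for A i
  proof -
    have "((w \<cdot>\<^sub>m 1\<^sub>m n - A) *\<^sub>v ones_vec n) $ i = (\<Sum>j<n. (w \<cdot>\<^sub>m 1\<^sub>m n - A) $$ (i, j) * 1)"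
      using A i by (simp add: mat_vec_entry[of _ n n] ones_vec_def minus_carrier_mat[of _ n n] del: index_mult_mat_vec)
    also have "\<dots> = (\<Sum>j<n. (if j = i then w else 0) - A $$ (i, j))"
      using A i by (intro sum.cong) auto
    finally show ?thesis using i by (simp add: sum_subtractf)
  qed
  show "i < n \<Longrightarrow> j < n \<Longrightarrow> Y_tilde n w Y $$ (i, j) = Y $$ (i, j) + 2 * w"
    using Y by (simp add: Y_tilde_def ones_mat_def)
  show "i < n \<Longrightarrow> Y_tilde n w Y $$ (i, n) = sqrt 2 * (w - (\<Sum>j<n. Y $$ (i, j)))"
    using Y sv[OF Y, of i] by (simp add: Y_tilde_def ones_mat_def mat_of_cols_index del: index_mult_mat_vec)
  show "j < n \<Longrightarrow> Y_tilde n w Y $$ (n, j) = sqrt 2 * (w - (\<Sum>i<n. Y $$ (i, j)))"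
    using Y sv[of "transpose_mat Y" j] by (simp add: Y_tilde_def ones_mat_def del: index_mult_mat_vec)
  show "Y_tilde n w Y $$ (n, n) = w + 2 * (\<Sum>i<n. \<Sum>j<n. Y $$ (i, j))"
    using Y by (simp add: Y_tilde_def ones_mat_def ones_vec_def scalar_prod_def atLeast0LessThan)
qed

text \<open>
  The coordinates \<open>i < n\<close> of the eigenvector equation give the last column, and the coordinate
  \<open>n\<close> gives the corner. Applied to the transpose it gives the last row, and the corner again.
\<close>

lemma eigen_folded_ones_odd:
  assumes U: "U \<in> carrier_mat (n + 1) (n + 1)"
  shows "U *\<^sub>v folded_ones (n + 1) n = c \<cdot>\<^sub>v folded_ones (n + 1) n \<longleftrightarrow>
    (\<forall>i<n. U $$ (i, n) = sqrt 2 * (c - (\<Sum>j<n. U $$ (i, j)))) \<and>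
    U $$ (n, n) = c - sqrt 2 * (\<Sum>j<n. U $$ (n, j))"
proof -
  have e: "(U *\<^sub>v folded_ones (n + 1) n) $ i = sqrt 2 * (\<Sum>j<n. U $$ (i, j)) + U $$ (i, n)"
    if "i < n + 1" for i
    using that U by (simp add: mat_vec_entry[OF U] folded_ones_def sum_distrib_left mult.commute
        del: index_mult_mat_vec)
  have "U *\<^sub>v folded_ones (n + 1) n = c \<cdot>\<^sub>v folded_ones (n + 1) n \<longleftrightarrow>
     (\<forall>i<n + 1. (U *\<^sub>v folded_ones (n + 1) n) $ i = (c \<cdot>\<^sub>v folded_ones (n + 1) n) $ i)"
    using U by (auto simp: vec_eq_iff folded_ones_def simp del: index_mult_mat_vec)
  also have "\<dots> \<longleftrightarrow> (\<forall>i<n. sqrt 2 * (\<Sum>j<n. U $$ (i, j)) + U $$ (i, n) = c * sqrt 2) \<and>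
      sqrt 2 * (\<Sum>j<n. U $$ (n, j)) + U $$ (n, n) = c"
  proof -
    have "folded_ones (n + 1) n $ i = (if i < n then sqrt 2 else 1)" if "i < n + 1" for i
      using that by (simp add: folded_ones_def)
    then have "(c \<cdot>\<^sub>v folded_ones (n + 1) n) $ i = (if i < n then c * sqrt 2 else c)"
      if "i < n + 1" for i
      using that by (simp add: folded_ones_def)
    then show ?thesis
      using e by (auto simp: less_Suc_eq simp del: index_mult_mat_vec)
  qed
  finally show ?thesis by (auto simp: algebra_simps)
qed

text \<open>
  The shift by \<open>2 w\<close> adds \<open>2 n w\<close> to the trace and the corner adds another \<open>w\<close>, which explains
  why the trace condition on \<open>Y\<close> itself is free of \<open>w\<close>.
\<close>

lemma mtrace_Y_tilde:
  assumes Y: "Y \<in> carrier_mat n n"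
  shows "mtrace (Y_tilde n w Y) =
    mtrace Y + 2 * (ones_vec n \<bullet> (Y *\<^sub>v ones_vec n)) + real (2 * n + 1) * w"
proof -
  have "dim_row (Y_tilde n w Y) = Suc n" using Y_tilde_carrier[OF Y, of w] by auto
  moreover have "ones_vec n \<bullet> (Y *\<^sub>v ones_vec n) = (\<Sum>i<n. \<Sum>j<n. Y $$ (i, j))"
    using Y by (simp add: ones_vec_def scalar_prod_def atLeast0LessThan)
  ultimately show ?thesis
    using Y by (simp add: mtrace_def Y_tilde_entries[OF Y] sum.distrib algebra_simps)
qed

text \<open>
  The leading block of \<open>U\<close> is arbitrary and the eigenvector equations determine the rest. The
  shift by \<open>2 w\<close> changes its line sums by \<open>2 n w\<close> and so reduces the required \<open>(2 n + 1) w\<close> in the last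
  row and column to \<open>w\<close>. The row and the column equation for the corner agree, because both
  involve only the sum of all entries of \<open>Y\<close>.
\<close>

lemma Y_tilde_eigen_iff:
  assumes U: "U \<in> carrier_mat (n + 1) (n + 1)"
  shows "U *\<^sub>v folded_ones (n + 1) n = (real (2 * n + 1) * w) \<cdot>\<^sub>v folded_ones (n + 1) n \<and>
    transpose_mat U *\<^sub>v folded_ones (n + 1) n = (real (2 * n + 1) * w) \<cdot>\<^sub>v folded_ones (n + 1) n \<longleftrightarrow>
    (\<exists>Y\<in>carrier_mat n n. U = Y_tilde n w Y)" (is "?L \<longleftrightarrow> ?R")
proof
  have UT: "transpose_mat U \<in> carrier_mat (n + 1) (n + 1)" using U by simp
  note eig = eigen_folded_ones_odd[OF U] eigen_folded_ones_odd[OF UT]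
  {
    assume ?L
    then have q: "\<And>i. i < n \<Longrightarrow> U $$ (i, n) = sqrt 2 * (real (2 * n + 1) * w - (\<Sum>j<n. U $$ (i, j)))"
      and r: "\<And>j. j < n \<Longrightarrow> U $$ (n, j) = sqrt 2 * (real (2 * n + 1) * w - (\<Sum>i<n. U $$ (i, j)))"
      and s: "U $$ (n, n) = real (2 * n + 1) * w - sqrt 2 * (\<Sum>j<n. U $$ (n, j))"
      unfolding eig using U by auto
    define Y where "Y = mat n n (\<lambda>(i, j). U $$ (i, j) - 2 * w)"
    have Y: "Y \<in> carrier_mat n n" by (simp add: Y_def)
    have "U = Y_tilde n w Y"
    proof (rule eq_matI)
      fix i j assume "i < dim_row (Y_tilde n w Y)" "j < dim_col (Y_tilde n w Y)"
      then have ij: "i < Suc n" "j < Suc n" using Y_tilde_carrier[OF Y, of w] by auto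
      have rs: "(\<Sum>j<n. Y $$ (i, j)) = (\<Sum>j<n. U $$ (i, j)) - 2 * real n * w" if "i < n" for i
        using that by (simp add: Y_def sum_subtractf)
      have cs: "(\<Sum>i<n. Y $$ (i, j)) = (\<Sum>i<n. U $$ (i, j)) - 2 * real n * w" if "j < n" for j
        using that by (simp add: Y_def sum_subtractf)
      have "(\<Sum>j<n. U $$ (n, j)) = sqrt 2 * (\<Sum>j<n. w - (\<Sum>i<n. Y $$ (i, j)))"
        by (simp add: r cs sum_distrib_left algebra_simps)
      also have "\<dots> = sqrt 2 * (real n * w - (\<Sum>i<n. \<Sum>j<n. Y $$ (i, j)))"
        by (subst sum.swap) (simp add: sum_subtractf)
      finally have "sqrt 2 * (\<Sum>j<n. U $$ (n, j)) =
          (sqrt 2 * sqrt 2) * (real n * w - (\<Sum>i<n. \<Sum>j<n. Y $$ (i, j)))"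
        by (simp only: mult.assoc)
      then have "U $$ (n, n) = w + 2 * (\<Sum>i<n. \<Sum>j<n. Y $$ (i, j))"
        using s by (simp add: algebra_simps)
      then show "U $$ (i, j) = Y_tilde n w Y $$ (i, j)"
        using ij q r by (auto simp: less_Suc_eq Y_tilde_entries[OF Y] rs cs algebra_simps)
          (simp_all add: Y_def)
    qed (use U Y_tilde_carrier[OF Y, of w] in auto)
    then show ?R using Y by blast
  next
    assume ?R
    then obtain Y where Y: "Y \<in> carrier_mat n n" and UY: "U = Y_tilde n w Y" by blast
    have "(\<Sum>j<n. w - (\<Sum>i<n. Y $$ (i, j))) = real n * w - (\<Sum>i<n. \<Sum>j<n. Y $$ (i, j))"
      by (subst sum.swap) (simp add: sum_subtractf)
    moreover have "(\<Sum>i<n. w - (\<Sum>j<n. Y $$ (i, j))) = real n * w - (\<Sum>i<n. \<Sum>j<n. Y $$ (i, j))"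
      by (simp add: sum_subtractf)
    moreover have "sqrt 2 * (sqrt 2 * x) = 2 * x" for x :: real
      by (simp add: mult.assoc[symmetric])
    ultimately show ?L
      unfolding eig using U
      by (auto simp: UY Y_tilde_entries[OF Y] sum.distrib sum_distrib_left[symmetric])
        (simp_all add: algebra_simps)
  }
qed

theorem theorem4:
  fixes n :: nat and w :: real
  shows
    "(\<forall>M \<in> carrier_mat (2 * n) (2 * n).
        (magic (2 * n) w M \<and> balanced (2 * n) M) \<longleftrightarrow>
        (\<exists>Y Z. semimagic n (2 * w) Y \<and> mtrace Y = 2 * real n * w \<and>
               Z \<in> carrier_mat n n \<and> mtrace Z = 0 \<and>
               M = X_even n * four_block_mat Y (0\<^sub>m n n) (0\<^sub>m n n) Z * X_even n))
     \<and>
     (\<forall>M \<in> carrier_mat (2 * n + 1) (2 * n + 1).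
        (magic (2 * n + 1) w M \<and> balanced (2 * n + 1) M) \<longleftrightarrow>
        (\<exists>Y Z. Y \<in> carrier_mat n n \<and> Z \<in> carrier_mat n n \<and>
               mtrace Y = - 2 * (ones_vec n \<bullet> (Y *\<^sub>v ones_vec n)) \<and> mtrace Z = 0 \<and>
               M = X_odd n * four_block_mat (Y_tilde n w Y) (0\<^sub>m (n + 1) n) (0\<^sub>m n (n + 1)) Z
                     * X_odd n))
     \<and>
     (\<forall>Y \<in> carrier_mat n n.
        mtrace Y = - 2 * (ones_vec n \<bullet> (Y *\<^sub>v ones_vec n)) \<longleftrightarrow>
        mtrace (Y_tilde n w Y) = real (2 * n + 1) * w)"
proof (intro conjI ballI)
  fix M :: "real mat" assume M: "M \<in> carrier_mat (2 * n) (2 * n)"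
  have car: "semimagic n (2 * w) Y \<Longrightarrow> Y \<in> carrier_mat n n" for Y
    by (simp add: semimagic_def)
  show "(magic (2 * n) w M \<and> balanced (2 * n) M) \<longleftrightarrow>
        (\<exists>Y Z. semimagic n (2 * w) Y \<and> mtrace Y = 2 * real n * w \<and>
               Z \<in> carrier_mat n n \<and> mtrace Z = 0 \<and>
               M = X_even n * four_block_mat Y (0\<^sub>m n n) (0\<^sub>m n n) Z * X_even n)"
    unfolding magic_balanced_iff[of n n "2 * n" M w, OF _ _ M, simplified] X_even_eq
    using semimagic_iff_folded[of _ n w] car by auto
next
  fix M :: "real mat" assume M: "M \<in> carrier_mat (2 * n + 1) (2 * n + 1)"
  have mt: "mtrace Y = - 2 * (ones_vec n \<bullet> (Y *\<^sub>v ones_vec n)) \<longleftrightarrow>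
      mtrace (Y_tilde n w Y) = real (2 * n + 1) * w" if "Y \<in> carrier_mat n n" for Y
    using mtrace_Y_tilde[OF that, of w] by linarith
  have hl: "n + 1 = n \<or> n + 1 = Suc n" and m: "2 * n + 1 = n + 1 + n" by simp_all
  have "(magic (2 * n + 1) w M \<and> balanced (2 * n + 1) M) \<longleftrightarrow>
    (\<exists>U\<in>carrier_mat (n + 1) (n + 1). \<exists>Z\<in>carrier_mat n n.
       M = X_odd n * four_block_mat U (0\<^sub>m (n + 1) n) (0\<^sub>m n (n + 1)) Z * X_odd n \<and>
       (\<exists>Y\<in>carrier_mat n n. U = Y_tilde n w Y) \<and>
       mtrace U = real (2 * n + 1) * w \<and> mtrace Z = 0)"
    unfolding X_odd_eq
    unfolding magic_balanced_iff[of "n + 1" n "2 * n + 1" M w, OF hl m M]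
    using Y_tilde_eigen_iff[of _ n w] by blast
  also have "\<dots> \<longleftrightarrow> (\<exists>Y Z. Y \<in> carrier_mat n n \<and> Z \<in> carrier_mat n n \<and>
               mtrace Y = - 2 * (ones_vec n \<bullet> (Y *\<^sub>v ones_vec n)) \<and> mtrace Z = 0 \<and>
               M = X_odd n * four_block_mat (Y_tilde n w Y) (0\<^sub>m (n + 1) n) (0\<^sub>m n (n + 1)) Z
                     * X_odd n)"
    using mt Y_tilde_carrier[of _ n w] by metis
  finally show "(magic (2 * n + 1) w M \<and> balanced (2 * n + 1) M) \<longleftrightarrow>
        (\<exists>Y Z. Y \<in> carrier_mat n n \<and> Z \<in> carrier_mat n n \<and>
               mtrace Y = - 2 * (ones_vec n \<bullet> (Y *\<^sub>v ones_vec n)) \<and> mtrace Z = 0 \<and>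
               M = X_odd n * four_block_mat (Y_tilde n w Y) (0\<^sub>m (n + 1) n) (0\<^sub>m n (n + 1)) Z
                     * X_odd n)" .
next
  fix Y :: "real mat" assume "Y \<in> carrier_mat n n"
  then show "mtrace Y = - 2 * (ones_vec n \<bullet> (Y *\<^sub>v ones_vec n)) \<longleftrightarrow>
        mtrace (Y_tilde n w Y) = real (2 * n + 1) * w"
    using mtrace_Y_tilde[of Y n w] by linarith
qed

end
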